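(* Let $k\ge 2$ and let $T$ be a set of permutations, all of length at least $k$. Then every permutation of length $n>k$ has at most $C_{n-k+2}$ preimages under the map $s_T$, where $C_m=\frac{1}{m+1}\binom{2m}{m}$ is the $m$th Catalan number.
   Context: A sequence of distinct integers contains a permutation $\tau$ if some subsequence is order-isomorphic to $\tau$; otherwise it avoids $\tau$, and it avoids a set $T$ if it avoids each element of $T$. For a set $T$ of permutations (each of length at least 2), the map $s_T$ (from permutations of length $n$ to permutations of length $n$) is defined by: read the input permutation left to right with an initially empty stack and output; at each step, if there is a next input element and pushing it keeps the stack contents, read from top to bottom, $T$-avoiding, push it; otherwise pop the top of the stack and append it to the output; stop when input and stack are empty; the output is $s_T(\pi)$. *)

theory Defs
  imports Complex_Main "HOL-Library.Sublist" "HOL-Combinatorics.Multiset_Permutations"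
begin

text \<open>A permutation of length \<open>n\<close> is its one-line notation, a list in
  \<^term>\<open>permutations_of_set {1..n}\<close>.\<close>

definition order_isomorphic :: "nat list \<Rightarrow> nat list \<Rightarrow> bool" where
  "order_isomorphic xs ys \<longleftrightarrow> length xs = length ys \<and>
     (\<forall>i < length xs. \<forall>j < length xs. xs ! i < xs ! j \<longleftrightarrow> ys ! i < ys ! j)"

definition contains_pattern :: "nat list \<Rightarrow> nat list \<Rightarrow> bool" where
  "contains_pattern xs \<tau> \<longleftrightarrow> (\<exists>ys. subseq ys xs \<and> order_isomorphic ys \<tau>)"

definition avoids :: "nat list \<Rightarrow> nat list set \<Rightarrow> bool" where
  "avoids xs T \<longleftrightarrow> (\<forall>\<tau>\<in>T. \<not> contains_pattern xs \<tau>)"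

text \<open>\<open>stack_run T st inp\<close> is the output still to be produced from stack \<open>st\<close> (head is the top)
  and remaining input \<open>inp\<close>. The case of an empty stack on which the next input
  cannot be pushed never occurs if all patterns have length at least 2; its value is arbitrary.\<close>

function stack_run :: "nat list set \<Rightarrow> nat list \<Rightarrow> nat list \<Rightarrow> nat list" where
  "stack_run T [] [] = []"
| "stack_run T (y # ys) [] = y # stack_run T ys []"
| "stack_run T [] (x # xs) = (if avoids [x] T then stack_run T [x] xs else [])"
| "stack_run T (y # ys) (x # xs) =
     (if avoids (x # y # ys) T then stack_run T (x # y # ys) xs
      else y # stack_run T ys (x # xs))"
  by pat_completeness auto
termination
  by (relation "measure (\<lambda>(T, st, inp). length st + 2 * length inp)") auto

definition stack_sort :: "nat list set \<Rightarrow> nat list \<Rightarrow> nat list" where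
  "stack_sort T \<pi> = stack_run T [] \<pi>"

definition catalan :: "nat \<Rightarrow> real" where
  "catalan m = 1 / (real m + 1) * real ((2 * m) choose m)"

lemma avoids_singleton:
  assumes "\<forall>\<tau>\<in>T. 2 \<le> length \<tau>"
  shows "avoids [x] T"
proof -
  have "\<not> contains_pattern [x] \<tau>" if "\<tau> \<in> T" for \<tau>
  proof
    assume "contains_pattern [x] \<tau>"
    then obtain ys where "subseq ys [x]" "length ys = length \<tau>"
      by (auto simp: contains_pattern_def order_isomorphic_def)
    moreover from this have "length ys \<le> 1"
      using list_emb_length by fastforce
    ultimately show False using assms that by fastforce
  qed
  then show ?thesis by (simp add: avoids_def)
qed

lemma mset_stack_run:
  assumes "\<forall>\<tau>\<in>T. 2 \<le> length \<tau>"
  shows "mset (stack_run T st inp) = mset st + mset inp"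
  using assms by (induction T st inp rule: stack_run.induct) (auto simp: avoids_singleton)

lemma stack_sort_permutation:
  assumes "\<forall>\<tau>\<in>T. 2 \<le> length \<tau>" "\<pi> \<in> permutations_of_set {1..n}"
  shows "stack_sort T \<pi> \<in> permutations_of_set {1..n}"
proof -
  have "mset (stack_sort T \<pi>) = mset \<pi>"
    using mset_stack_run[OF assms(1), of "[]" \<pi>] by (simp add: stack_sort_def)
  then show ?thesis
    using assms(2) by (metis mset_eq_imp_distinct_iff mset_eq_setD permutations_of_setD permutations_of_setI)
qed

end

theory Submission imports Defs begin

text \<open>Since short stacks avoid \<open>T\<close>, no element is popped from a stack with fewer than \<open>k - 1\<close>
  elements while input remains. Hence the height of the stack, lowered by \<open>k - 2\<close>, describes a
  Dyck path of semilength \<open>n - k + 2\<close>. Running the machine backwards, the output and the path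
  determine the input.\<close>

text \<open>\<open>ballot h m\<close> counts the lattice paths that start at height \<open>h\<close>, stay nonnegative, have
  exactly \<open>m\<close> up steps, and end with an up step or are empty.\<close>

fun ballot :: "nat \<Rightarrow> nat \<Rightarrow> nat" where
  "ballot h 0 = 1"
| "ballot 0 (Suc m) = ballot 1 m"
| "ballot (Suc h) (Suc m) = ballot (Suc (Suc h)) m + ballot h (Suc m)"

text \<open>The reflection principle gives a difference of two binomials, written here as a sum to
  avoid subtraction on naturals. The recursion of \<open>ballot\<close> turns into Pascal's
  rule.\<close>

lemma ballot_Suc_plus_binomial:
  "ballot h (Suc m) + ((2 * m + 2 + h) choose m) = (2 * m + 2 + h) choose Suc m"
proof (induction h "Suc m" arbitrary: m rule: ballot.induct)
  case (2 m)
  show ?case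
  proof (cases m)
    case (Suc j)
    \<comment> \<open>At height 0 the recursion has only the up step; the symmetry of an odd row
      makes up for the missing down step.\<close>
    have "(2 * j + 3) choose Suc j = (2 * j + 3) choose Suc (Suc j)"
      by (subst binomial_symmetric) auto
    with 2[of j] Suc show ?thesis by (simp add: numeral_eq_Suc)
  qed simp
next
  case (3 h m)
  show ?case
  proof (cases m)
    case (Suc j)
    with 3(1)[of j] 3(2) show ?thesis by (simp add: numeral_eq_Suc)
  qed (use 3 in simp)
qed

lemma ballot_0_eq_catalan: "real (ballot 0 m) = catalan m"
proof (cases m)
  case (Suc j)
  let ?N = "2 * j + 2"
  \<comment> \<open>Substituting \<open>c = b + d\<close> and cancelling gives
    \<open>d = (j + 1) * b\<close>.\<close>
  have arith: "(j + 2) * b = c" if "Suc j * c = (j + 2) * d" "b + d = c" for b c d :: nat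
    using that(1) unfolding that(2)[symmetric] by (simp add: algebra_simps)
  have "Suc j * (?N choose Suc j) = (j + 2) * (?N choose j)"
    using Suc_times_binomial_add[of j "Suc j"] by (simp add: mult_2)
  moreover have "ballot 0 (Suc j) + (?N choose j) = ?N choose Suc j"
    using ballot_Suc_plus_binomial[of 0 j] by simp
  ultimately have "(j + 2) * ballot 0 (Suc j) = ?N choose Suc j"
    by (rule arith)
  then have "(real j + 2) * real (ballot 0 (Suc j)) = real (?N choose Suc j)"
    by (metis of_nat_add of_nat_mult of_nat_numeral)
  then show ?thesis
    unfolding Suc catalan_def by (simp add: field_simps del: ballot.simps binomial_Suc_Suc)
qed (simp add: catalan_def)

lemma avoids_short:
  assumes "\<forall>\<tau>\<in>T. length xs < length \<tau>"
  shows "avoids xs T"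
  using assms unfolding avoids_def contains_pattern_def order_isomorphic_def
  by (metis leD list_emb_length)

lemma stack_run_Nil [simp]: "stack_run T st [] = st"
  by (induction st) auto

text \<open>Even after the push the stack is shorter than every pattern, so the push is
  forced.\<close>

lemma stack_run_push:
  assumes "\<forall>\<tau>\<in>T. k \<le> length \<tau>" "Suc (length st) < k"
  shows "stack_run T st (x # xs) = stack_run T (x # st) xs"
proof -
  have "avoids (x # st) T"
    using assms by (intro avoids_short) auto
  then show ?thesis by (cases st) auto
qed

text \<open>Intermediate states of the machine are counted, not just inputs, so that the induction
  can follow single steps; \<open>h\<close> and \<open>m\<close> match the arguments of
  \<open>ballot\<close> up to a shift in height.\<close>

definition run_preimages :: "nat list set \<Rightarrow> nat \<Rightarrow> nat \<Rightarrow> nat list \<Rightarrow> (nat list \<times> nat list) set" where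
  "run_preimages T h m \<rho> =
     {(st, inp). length st = h \<and> length inp = m \<and> stack_run T st inp = \<rho>}"

lemma run_preimages_0: "run_preimages T h 0 \<rho> \<subseteq> {(\<rho>, [])}"
  by (auto simp: run_preimages_def)

definition unpush :: "nat list \<times> nat list \<Rightarrow> nat list \<times> nat list" where
  "unpush = (\<lambda>(st, inp). (tl st, hd st # inp))"

lemma run_preimages_push:
  assumes "\<forall>\<tau>\<in>T. k \<le> length \<tau>" "Suc h < k"
  shows "run_preimages T h (Suc m) \<rho> \<subseteq> unpush ` run_preimages T (Suc h) m \<rho>"
proof clarify
  fix st inp assume "(st, inp) \<in> run_preimages T h (Suc m) \<rho>"
  then obtain x xs where "inp = x # xs" "length st = h" "length xs = m"
    "stack_run T st (x # xs) = \<rho>"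
    by (auto simp: run_preimages_def length_Suc_conv)
  then show "(st, inp) \<in> unpush ` run_preimages T (Suc h) m \<rho>"
    using stack_run_push[OF assms(1), of st x xs] assms(2)
    by (intro image_eqI[of _ _ "(x # st, xs)"]) (auto simp: run_preimages_def unpush_def)
qed

text \<open>Either move can be undone from \<rho> alone: a popped element is the next output, hence
  \<open>hd \<rho>\<close>.\<close>

lemma run_preimages_push_or_pop:
  "run_preimages T (Suc h) (Suc m) \<rho> \<subseteq>
     unpush ` run_preimages T (Suc (Suc h)) m \<rho> \<union>
     map_prod (Cons (hd \<rho>)) id ` run_preimages T h (Suc m) (tl \<rho>)"
proof clarify
  fix st inp
  assume *: "(st, inp) \<in> run_preimages T (Suc h) (Suc m) \<rho>"
    and no_pop: "(st, inp) \<notin> map_prod (Cons (hd \<rho>)) id ` run_preimages T h (Suc m) (tl \<rho>)"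
  from * obtain y ys x xs where eq: "st = y # ys" "inp = x # xs" "length ys = h" "length xs = m"
    and run: "stack_run T (y # ys) (x # xs) = \<rho>"
    by (auto simp: run_preimages_def length_Suc_conv)
  have "avoids (x # y # ys) T"
  proof (rule ccontr)
    assume "\<not> avoids (x # y # ys) T"
    then have "\<rho> = y # stack_run T ys (x # xs)" using run by simp
    then have "(st, inp) \<in> map_prod (Cons (hd \<rho>)) id ` run_preimages T h (Suc m) (tl \<rho>)"
      using eq by (intro image_eqI[of _ _ "(ys, inp)"]) (auto simp: run_preimages_def)
    with no_pop show False by contradiction
  qed
  then show "(st, inp) \<in> unpush ` run_preimages T (Suc (Suc h)) m \<rho>"
    using eq run
    by (intro image_eqI[of _ _ "(x # y # ys, xs)"]) (auto simp: run_preimages_def unpush_def)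
qed

text \<open>An infinite set has \<open>card\<close> 0, so a bound on \<open>card\<close> alone would
  not pass to subsets; finiteness travels with it.\<close>

lemma finite_card_image_cover:
  assumes "A \<subseteq> f ` B" "finite B" "card B \<le> b"
  shows "finite A \<and> card A \<le> b"
  using assms by (meson finite_imageI finite_subset order_trans surj_card_le)

text \<open>Path height 0 stands for a stack of \<open>k\<close> elements: one more still leaves it
  shorter than \<open>k + 2\<close>, so there, as in \<open>ballot\<close>, only the up step
  remains.\<close>

lemma card_run_preimages_le_ballot:
  assumes "\<forall>\<tau>\<in>T. k + 2 \<le> length \<tau>"
  shows "finite (run_preimages T (h + k) m \<rho>) \<and> card (run_preimages T (h + k) m \<rho>) \<le> ballot h m"
proof (induction h m arbitrary: \<rho> rule: ballot.induct)
  case (1 h)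
  show ?case
    using card_mono[OF _ run_preimages_0[of T "h + k" \<rho>]]
      finite_subset[OF run_preimages_0[of T "h + k" \<rho>]] by simp
next
  case (2 m)
  show ?case
    using finite_card_image_cover[OF run_preimages_push[OF assms, of k m \<rho>], of "ballot 1 m"] 2[of \<rho>] by simp
next
  case (3 h m)
  let ?A = "unpush ` run_preimages T (Suc (Suc h) + k) m \<rho>"
  let ?B = "map_prod (Cons (hd \<rho>)) id ` run_preimages T (h + k) (Suc m) (tl \<rho>)"
  have A: "finite ?A \<and> card ?A \<le> ballot (Suc (Suc h)) m"
    using finite_card_image_cover[OF subset_refl] 3(1)[of \<rho>] by blast
  have B: "finite ?B \<and> card ?B \<le> ballot h (Suc m)"
    using finite_card_image_cover[OF subset_refl] 3(2)[of "tl \<rho>"] by blast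
  have sub: "run_preimages T (Suc h + k) (Suc m) \<rho> \<subseteq> ?A \<union> ?B"
    using run_preimages_push_or_pop[of T "h + k" m \<rho>] by simp
  have "card (run_preimages T (Suc h + k) (Suc m) \<rho>) \<le> card (?A \<union> ?B)"
    using A B sub by (intro card_mono) auto
  also have "\<dots> \<le> card ?A + card ?B" by (rule card_Un_le)
  finally have "card (run_preimages T (Suc h + k) (Suc m) \<rho>) \<le> ballot (Suc h) (Suc m)"
    using A B by simp
  moreover have "finite (run_preimages T (Suc h + k) (Suc m) \<rho>)"
    using A B sub by (meson finite_UnI finite_subset)
  ultimately show ?case by blast
qed

text \<open>Below height \<open>k\<close> every move is a forced push, so climbing from
  \<open>j\<close> to \<open>k\<close> uses \<open>k - j\<close> inputs without branching.\<close>

lemma card_run_preimages_initial: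
  assumes "\<forall>\<tau>\<in>T. k + 2 \<le> length \<tau>" "j \<le> k"
  shows "finite (run_preimages T j (k - j + m) \<rho>) \<and>
    card (run_preimages T j (k - j + m) \<rho>) \<le> ballot 0 m"
  using assms(2)
proof (induction rule: inc_induct)
  case base
  show ?case using card_run_preimages_le_ballot[OF assms(1), of 0 m \<rho>] by simp
next
  case (step j)
  have "k - j + m = Suc (k - Suc j + m)" using step by simp
  then show ?case
    using finite_card_image_cover[OF run_preimages_push[OF assms(1), of j "k - Suc j + m" \<rho>],
        of "ballot 0 m"] step
    by simp
qed

theorem theorem3p1:
  fixes k n :: nat and T :: "nat list set" and \<sigma> :: "nat list"
  assumes "k \<ge> 2"
    and "\<forall>\<tau>\<in>T. \<exists>m\<ge>k. \<tau> \<in> permutations_of_set {1..m}"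
    and "n > k"
    and "\<sigma> \<in> permutations_of_set {1..n}"
  shows "real (card {\<pi> \<in> permutations_of_set {1..n}. stack_sort T \<pi> = \<sigma>}) \<le> catalan (n - k + 2)"
proof -
  let ?P = "{\<pi> \<in> permutations_of_set {1..n}. stack_sort T \<pi> = \<sigma>}"
  have "\<forall>\<tau>\<in>T. (k - 2) + 2 \<le> length \<tau>"
    using assms(1,2) by (fastforce dest: length_finite_permutations_of_set)
  \<comment> \<open>The first \<open>k - 2\<close> pushes are forced; the other
    \<open>n - k + 2\<close> inputs are the up steps of the path.\<close>
  moreover have "k - 2 - 0 + (n - k + 2) = n" using assms(1,3) by simp
  ultimately have run: "finite (run_preimages T 0 n \<sigma>)"
    "card (run_preimages T 0 n \<sigma>) \<le> ballot 0 (n - k + 2)"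
    using card_run_preimages_initial[of T "k - 2" 0 "n - k + 2" \<sigma>] by (metis le0)+
  have "?P \<subseteq> snd ` run_preimages T 0 n \<sigma>"
  proof
    fix \<pi> assume "\<pi> \<in> ?P"
    then have "([], \<pi>) \<in> run_preimages T 0 n \<sigma>"
      by (auto simp: run_preimages_def stack_sort_def dest: length_finite_permutations_of_set)
    then show "\<pi> \<in> snd ` run_preimages T 0 n \<sigma>" by force
  qed
  then have "card ?P \<le> ballot 0 (n - k + 2)"
    using finite_card_image_cover run by blast
  then show ?thesis
    by (metis ballot_0_eq_catalan of_nat_le_iff)
qed

end
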